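(* Let $n\ge2$, $L>0$, $\mathbb T_L^n:=\mathbb R^n/L\mathbb Z^n$, let $V\in C^2(\mathbb T_L^n;\mathbb R^n)$ be divergence free, let $d>0$, and define $$H(x,q):=\left(1+d\,\frac{q^{\mathsf T}S_V(x)q}{|q|^2}\right)_+|q|+V(x)\cdot q\quad(q\neq0),\qquad H(x,0):=0.$$ There exists $\varepsilon_0>0$, depending only on $d$, $L$, and $\|V\|_{C^2}$, such that for every $\varepsilon$ with $0\le\varepsilon\le\varepsilon_0$, every $\varepsilon$-outward barrier certificate $D\subset\mathbb T_L^n$ for $H$ satisfies $$R(D)\le2d\varepsilon.$$ In particular, every exact outward barrier certificate (the case $\varepsilon=0$) is the whole torus: $D=\mathbb T_L^n$.
   Context: $S_V=(DV+DV^{\mathsf T})/2$ and $(a)_+=\max\{a,0\}$. $\operatorname{dist}$ is the geodesic distance on the flat torus $\mathbb T_L^n$; for a nonempty closed set $D$, $\operatorname{dist}(y,D)=\inf_{x\in D}\operatorname{dist}(y,x)$ and $R(D):=\max_{y\in\mathbb T_L^n}\operatorname{dist}(y,D)$ (covering radius). A unit vector $\nu\in\mathbb R^n$ is a unit proximal outward normal of $D$ at $x\in D$ if, for some $r\in(0,L/2)$, the point $x$ is a nearest point of $D$ to $x+r\nu$ (in flat coordinates). A nonempty closed set $D\subset\mathbb T_L^n$ is an $\varepsilon$-outward barrier certificate for $H$ if $H(x,\nu)\le\varepsilon$ for every $x\in D$ and every unit proximal outward normal $\nu$ of $D$ at $x$. It is exact if $\varepsilon=0$. *)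

theory Defs
  imports "HOL-Analysis.Analysis"
begin

text \<open>The torus is the quotient of \<open>real^'n\<close> by the lattice \<open>L \<int>\<^sup>n\<close>; its points are the cosets themselves.\<close>

definition lattice :: "real \<Rightarrow> (real^'n) set" where
  "lattice L = {z. \<forall>i. \<exists>k::int. z $ i = L * of_int k}"

definition torus_proj :: "real \<Rightarrow> real^'n \<Rightarrow> (real^'n) set" where
  "torus_proj L x = {y. y - x \<in> lattice L}"

definition torus :: "real \<Rightarrow> (real^'n) set set" where
  "torus L = range (torus_proj L)"

text \<open>The point \<open>p + z\<close> in flat coordinates: translation of the coset \<open>p\<close> by the vector \<open>z\<close>.\<close>

definition tshift :: "(real^'n) set \<Rightarrow> real^'n \<Rightarrow> (real^'n) set"  (infixl "\<oplus>\<^sub>T" 65) where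
  "p \<oplus>\<^sub>T z = (\<lambda>x. x + z) ` p"

text \<open>Geodesic distance of the flat torus: the least Euclidean distance between representatives.\<close>

definition torus_dist :: "(real^'n) set \<Rightarrow> (real^'n) set \<Rightarrow> real" where
  "torus_dist p q = setdist p q"

definition torus_infdist :: "(real^'n) set \<Rightarrow> (real^'n) set set \<Rightarrow> real" where
  "torus_infdist p D = (INF q\<in>D. torus_dist p q)"

text \<open>For nonempty \<open>D\<close> and \<open>L > 0\<close> the supremum is a maximum, since the torus is compact.\<close>

definition covering_radius :: "real \<Rightarrow> (real^'n) set set \<Rightarrow> real" where
  "covering_radius L D = (SUP p\<in>torus L. torus_infdist p D)"

text \<open>Closedness in the quotient topology: \<open>\<Union>D\<close> is the preimage of \<open>D\<close> under the projection.\<close>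

definition torus_closed :: "real \<Rightarrow> (real^'n) set set \<Rightarrow> bool" where
  "torus_closed L D \<longleftrightarrow> D \<subseteq> torus L \<and> closed (\<Union>D)"

definition torus_continuous :: "real \<Rightarrow> ((real^'n) set \<Rightarrow> 'b::topological_space) \<Rightarrow> bool" where
  "torus_continuous L f \<longleftrightarrow> continuous_on UNIV (\<lambda>x. f (torus_proj L x))"

definition torus_differentiable :: "real \<Rightarrow> ((real^'n) set \<Rightarrow> 'b::real_normed_vector) \<Rightarrow> bool" where
  "torus_differentiable L f \<longleftrightarrow> (\<forall>p\<in>torus L. (\<lambda>z. f (p \<oplus>\<^sub>T z)) differentiable (at 0))"

definition tderiv :: "((real^'n) set \<Rightarrow> 'b::real_normed_vector) \<Rightarrow> (real^'n) set \<Rightarrow> ((real^'n) \<Rightarrow>\<^sub>L 'b)" where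
  "tderiv f p = Blinfun (frechet_derivative (\<lambda>z. f (p \<oplus>\<^sub>T z)) (at 0))"

definition torus_C2 :: "real \<Rightarrow> ((real^'n) set \<Rightarrow> 'b::real_normed_vector) \<Rightarrow> bool" where
  "torus_C2 L f \<longleftrightarrow> torus_differentiable L f \<and> torus_differentiable L (tderiv f)
     \<and> torus_continuous L (tderiv (tderiv f))"

text \<open>The derivatives are measured in operator norm.\<close>

definition C2_norm :: "real \<Rightarrow> ((real^'n) set \<Rightarrow> 'b::real_normed_vector) \<Rightarrow> real" where
  "C2_norm L f = (SUP p\<in>torus L. norm (f p)) + (SUP p\<in>torus L. norm (tderiv f p))
     + (SUP p\<in>torus L. norm (tderiv (tderiv f) p))"

definition jacobian :: "((real^'n) set \<Rightarrow> real^'n) \<Rightarrow> (real^'n) set \<Rightarrow> real^'n^'n" where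
  "jacobian V p = matrix (blinfun_apply (tderiv V p))"

definition divergence_free :: "real \<Rightarrow> ((real^'n) set \<Rightarrow> real^'n) \<Rightarrow> bool" where
  "divergence_free L V \<longleftrightarrow> (\<forall>p\<in>torus L. trace (jacobian V p) = 0)"

definition strain :: "((real^'n) set \<Rightarrow> real^'n) \<Rightarrow> (real^'n) set \<Rightarrow> real^'n^'n" where
  "strain V p = (1/2) *\<^sub>R (jacobian V p + transpose (jacobian V p))"

definition hamiltonian ::
    "real \<Rightarrow> ((real^'n) set \<Rightarrow> real^'n) \<Rightarrow> (real^'n) set \<Rightarrow> real^'n \<Rightarrow> real" where
  "hamiltonian d V p q =
     (if q = 0 then 0
      else max (1 + d * ((q \<bullet> (strain V p *v q)) / (norm q)\<^sup>2)) 0 * norm q + V p \<bullet> q)"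

definition unit_proximal_normal ::
    "real \<Rightarrow> (real^'n) set set \<Rightarrow> (real^'n) set \<Rightarrow> real^'n \<Rightarrow> bool" where
  "unit_proximal_normal L D p \<nu> \<longleftrightarrow> norm \<nu> = 1 \<and> p \<in> D \<and>
     (\<exists>r. 0 < r \<and> r < L / 2 \<and>
        (\<forall>q\<in>D. torus_dist (p \<oplus>\<^sub>T r *\<^sub>R \<nu>) p \<le> torus_dist (p \<oplus>\<^sub>T r *\<^sub>R \<nu>) q))"

definition barrier_certificate ::
    "real \<Rightarrow> ((real^'n) set \<Rightarrow> real^'n \<Rightarrow> real) \<Rightarrow> real \<Rightarrow> (real^'n) set set \<Rightarrow> bool" where
  "barrier_certificate L H \<epsilon> D \<longleftrightarrow> D \<noteq> {} \<and> torus_closed L D \<and>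
     (\<forall>p\<in>D. \<forall>\<nu>. unit_proximal_normal L D p \<nu> \<longrightarrow> H p \<nu> \<le> \<epsilon>)"

definition exact_barrier_certificate ::
    "real \<Rightarrow> ((real^'n) set \<Rightarrow> real^'n \<Rightarrow> real) \<Rightarrow> (real^'n) set set \<Rightarrow> bool" where
  "exact_barrier_certificate L H D \<longleftrightarrow> barrier_certificate L H 0 D"

end

theory Submission
  imports Defs
begin

text \<open>Lift everything to \<open>real^'n\<close>: \<open>v = V \<circ> torus_proj L\<close>, \<open>E = \<Union>D\<close> (a closed periodic set) and
  \<open>\<rho> = infdist _ E\<close>. The idea is that \<open>V\<close> transports a whole shell around the certificate towards it,
  which an incompressible flow on a compact manifold can do only if the shell is empty.

  Let \<open>x\<close> be a point of \<open>E\<close> nearest to \<open>y\<close> and \<open>\<nu> = (y - x) / \<rho>\<close>, a unit proximal normal at \<open>x\<close> when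
  \<open>0 < \<rho> < L / 2\<close>. With \<open>\<alpha> = V x \<bullet> \<nu>\<close> and \<open>\<beta> = \<nu> \<bullet> DV x \<nu>\<close>, the certificate says both \<open>\<alpha> \<le> \<epsilon>\<close> and
  \<open>1 + d \<beta> + \<alpha> \<le> \<epsilon>\<close>. The convex combination of these two with weights \<open>1 - \<rho>/d\<close> and \<open>\<rho>/d\<close> gives
  \<open>\<alpha> + \<rho> \<beta> \<le> \<epsilon> - \<rho>/d\<close>, and by Taylor's formula the left-hand side is \<open>V y \<bullet> \<nu>\<close> up to \<open>M \<rho>\<^sup>2\<close>, where
  \<open>M\<close> is the \<open>C\<^sup>2\<close> norm. So for \<open>2 d \<epsilon> < \<rho> < b\<close>, with \<open>b\<close> small in terms of \<open>d\<close>, \<open>L\<close> and \<open>M\<close>,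
  one has \<open>V y \<bullet> \<nu> \<le> - \<rho> / (4 d)\<close> (lemma \<open>inward_drift_near_certificate\<close>).

  If \<open>\<rho>\<close> were smooth, testing \<open>div V = 0\<close> against a function \<open>f(\<rho>)\<close> that increases exactly across the
  shell would finish the proof. Two properties replace smoothness. First, \<open>\<rho>\<^sup>2\<close> is semiconcave:
  \<open>\<rho>(y + h)\<^sup>2 \<le> \<rho>(y)\<^sup>2 + 2 (y - x) \<bullet> h + |h|\<^sup>2\<close>, and this one-sided bound passes to the test function \<open>g\<close>
  (lemma \<open>shell_height_sq_increment\<close>). Second, only increments of \<open>g\<close> with nonnegative coefficients
  are needed, and for these one-sided bounds suffice: for a constant \<open>K \<ge> |v\<^sub>i|\<close> the sum
  \<open>\<Sum>i. (v\<^sub>i y + K) (g (y + t e\<^sub>i) - g y) + K (g (y - t e\<^sub>i) - g y)\<close>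
  is a discrete form of \<open>t v \<bullet> \<nabla>g\<close>. It is bounded above by the semiconcavity of \<open>g\<close> and the drift
  (lemma \<open>shell_upwind_bound\<close>), while translation invariance of the integral over a period cell moves the
  differences onto \<open>v\<close>, where they sum to \<open>- t div v + O(t\<^sup>2) = O(t\<^sup>2)\<close>
  (lemmas \<open>integral_upwind_by_parts\<close> and \<open>divergence_free_difference_bound\<close>). Dividing by \<open>t\<close> and letting
  \<open>t\<close> tend to \<open>0\<close> shows that a continuous weight that is positive on the shell has integral \<open>0\<close>, so the shell
  is empty. As \<open>\<rho>\<close> is continuous and vanishes on \<open>E\<close>, it cannot jump across the shell, so
  \<open>\<rho> \<le> 2 d \<epsilon>\<close> everywhere.\<close>

section \<open>The torus as a quotient\<close>

lemma lattice_0 [simp]: "0 \<in> lattice L"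
  unfolding lattice_def by (auto intro!: exI[of _ "0::int"])

lemma lattice_uminus: "z \<in> lattice L \<Longrightarrow> - z \<in> lattice L"
  unfolding lattice_def
proof (clarsimp)
  fix i assume "\<forall>i. \<exists>k. z $ i = L * real_of_int k"
  then obtain k where "z $ i = L * real_of_int k" by blast
  then show "\<exists>k. - z $ i = L * real_of_int k"
    by (intro exI[of _ "- k"]) simp
qed

lemma lattice_add:
  assumes "z \<in> lattice L" "w \<in> lattice L"
  shows "z + w \<in> lattice L"
  unfolding lattice_def
proof (clarsimp)
  fix i
  obtain k l :: int where "z $ i = L * k" "w $ i = L * l"
    using assms unfolding lattice_def by blast
  then show "\<exists>k. z $ i + w $ i = L * real_of_int k"
    by (intro exI[of _ "k + l"]) (simp add: algebra_simps)
qed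

lemma axis_in_lattice: "(axis i L :: real^'n) \<in> lattice L"
  unfolding lattice_def
proof (clarsimp)
  fix j show "\<exists>k. (axis i L :: real^'n) $ j = L * real_of_int k"
    by (intro exI[of _ "if i = j then 1 else 0"]) (simp add: axis_def)
qed

lemma mem_torus_proj_iff: "y \<in> torus_proj L x \<longleftrightarrow> y - x \<in> lattice L"
  by (simp add: torus_proj_def)

lemma torus_proj_self [simp]: "x \<in> torus_proj L x"
  by (simp add: mem_torus_proj_iff)

lemma torus_proj_in_torus [simp]: "torus_proj L x \<in> torus L"
  by (simp add: torus_def)

lemma torus_proj_eqI:
  assumes "y - x \<in> lattice L"
  shows "torus_proj L y = torus_proj L x"
proof (rule set_eqI)
  fix z
  have "z - y \<in> lattice L \<longleftrightarrow> z - x \<in> lattice L"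
    using lattice_add[of "z - y" L "y - x"] lattice_add[of "z - x" L "x - y"]
      assms lattice_uminus[OF assms] by auto
  then show "z \<in> torus_proj L y \<longleftrightarrow> z \<in> torus_proj L x"
    by (simp add: mem_torus_proj_iff)
qed

lemma torus_proj_add_lattice:
  "z \<in> lattice L \<Longrightarrow> torus_proj L (x + z) = torus_proj L x"
  by (rule torus_proj_eqI) simp

lemma torus_eq_torus_proj:
  assumes "p \<in> torus L" "x \<in> p"
  shows "p = torus_proj L x"
  using assms torus_proj_eqI[of x _ L] unfolding torus_def by (auto simp: mem_torus_proj_iff)

lemma tshift_torus_proj: "torus_proj L x \<oplus>\<^sub>T z = torus_proj L (x + z)"
proof (rule set_eqI)
  fix y
  have "y \<in> torus_proj L x \<oplus>\<^sub>T z \<longleftrightarrow> y - z \<in> torus_proj L x"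
    unfolding tshift_def by (auto intro!: image_eqI[of _ _ "y - z"])
  then show "y \<in> torus_proj L x \<oplus>\<^sub>T z \<longleftrightarrow> y \<in> torus_proj L (x + z)"
    by (simp add: mem_torus_proj_iff algebra_simps)
qed

lemma exists_lattice_translate_in_cbox:
  fixes x :: "real^'n"
  assumes "L > 0"
  obtains z where "z \<in> lattice L" "x + z \<in> cbox 0 (\<chi> i. L)"
proof
  let ?z = "(\<chi> i. - (L * of_int \<lfloor>x $ i / L\<rfloor>)) :: real^'n"
  show "?z \<in> lattice L"
    unfolding lattice_def
  proof (clarsimp)
    fix i show "\<exists>k. - (L * real_of_int \<lfloor>x $ i / L\<rfloor>) = L * real_of_int k"
      by (intro exI[of _ "- \<lfloor>x $ i / L\<rfloor>"]) simp
  qed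
  have "0 \<le> x $ i - L * of_int \<lfloor>x $ i / L\<rfloor> \<and> x $ i - L * of_int \<lfloor>x $ i / L\<rfloor> \<le> L" for i
  proof -
    have "of_int \<lfloor>x $ i / L\<rfloor> \<le> x $ i / L" "x $ i / L \<le> of_int \<lfloor>x $ i / L\<rfloor> + 1"
      by linarith+
    then have "of_int \<lfloor>x $ i / L\<rfloor> * L \<le> x $ i" "x $ i \<le> (of_int \<lfloor>x $ i / L\<rfloor> + 1) * L"
      using assms by (simp_all only: pos_le_divide_eq pos_divide_le_eq)
    then show ?thesis
      by (simp add: algebra_simps)
  qed
  then show "x + ?z \<in> cbox 0 (\<chi> i. L)"
    by (simp add: mem_box_cart)
qed

lemma bounded_torus_image:
  fixes f :: "(real^'n) set \<Rightarrow> 'b::real_normed_vector"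
  assumes "L > 0" "torus_continuous L f"
  shows "bounded (f ` torus L)"
proof -
  let ?g = "\<lambda>x. f (torus_proj L x)"
  have "compact (?g ` cbox 0 (\<chi> i. L))"
    using assms(2) unfolding torus_continuous_def
    by (intro compact_continuous_image) (auto intro: continuous_on_subset)
  moreover have "f ` torus L \<subseteq> ?g ` cbox 0 (\<chi> i. L)"
  proof
    fix w assume "w \<in> f ` torus L"
    then obtain x where w: "w = ?g x" by (auto simp: torus_def)
    obtain z where z: "z \<in> lattice L" "x + z \<in> cbox 0 (\<chi> i. L)"
      using exists_lattice_translate_in_cbox[OF assms(1)] by blast
    then have "w = ?g (x + z)" by (simp add: w torus_proj_add_lattice)
    with z(2) show "w \<in> ?g ` cbox 0 (\<chi> i. L)" by blast
  qed
  ultimately show ?thesis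
    using bounded_subset compact_imp_bounded by blast
qed

section \<open>Derivatives of a twice differentiable field\<close>

lemma has_derivative_tderiv:
  fixes f :: "(real^'n) set \<Rightarrow> 'b::real_normed_vector"
  assumes "torus_differentiable L f"
  shows "((\<lambda>y. f (torus_proj L y)) has_derivative tderiv f (torus_proj L x)) (at x)"
proof -
  let ?h = "\<lambda>z. f (torus_proj L x \<oplus>\<^sub>T z)"
  have "?h differentiable (at 0)"
    using assms by (simp add: torus_differentiable_def)
  then have D: "(?h has_derivative frechet_derivative ?h (at 0)) (at 0)"
    by (simp add: frechet_derivative_works)
  then have "bounded_linear (frechet_derivative ?h (at 0))"
    by (rule has_derivative_bounded_linear)
  then have eq: "blinfun_apply (tderiv f (torus_proj L x)) = frechet_derivative ?h (at 0)"
    by (simp add: tderiv_def bounded_linear_Blinfun_apply)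
  have shift: "((\<lambda>y. y - x) has_derivative (\<lambda>y. y)) (at x)"
    by (auto intro!: derivative_eq_intros)
  have "((\<lambda>y. ?h (y - x)) has_derivative (\<lambda>y. frechet_derivative ?h (at 0) y)) (at x)"
    by (rule has_derivative_compose[OF shift]) (use D in simp)
  then show ?thesis
    by (simp add: eq tshift_torus_proj)
qed

lemma torus_differentiable_imp_continuous:
  fixes f :: "(real^'n) set \<Rightarrow> 'b::real_normed_vector"
  assumes "torus_differentiable L f"
  shows "torus_continuous L f"
  unfolding torus_continuous_def
  using has_derivative_continuous[OF has_derivative_tderiv[OF assms]]
  by (simp add: continuous_on_eq_continuous_at)

lemma norm_le_SUP_torus:
  fixes g :: "(real^'n) set \<Rightarrow> 'b::real_normed_vector"
  assumes "L > 0" "torus_continuous L g"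
  shows "norm (g (torus_proj L x)) \<le> (SUP p\<in>torus L. norm (g p))"
proof -
  have "bdd_above ((\<lambda>p. norm (g p)) ` torus L)"
    using bounded_torus_image[OF assms] by (auto simp: bounded_iff bdd_above_def)
  then show ?thesis
    by (rule cSUP_upper[rotated]) simp
qed

lemma norm_tderiv_tderiv_le_C2_norm:
  fixes f :: "(real^'n) set \<Rightarrow> 'b::real_normed_vector"
  assumes "L > 0" "torus_C2 L f"
  shows "norm (tderiv (tderiv f) (torus_proj L x)) \<le> C2_norm L f"
proof -
  have "torus_continuous L f" "torus_continuous L (tderiv f)" "torus_continuous L (tderiv (tderiv f))"
    using assms(2) torus_differentiable_imp_continuous by (auto simp: torus_C2_def)
  note le = this[THEN norm_le_SUP_torus[OF assms(1), of _ x]]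
  show ?thesis
    using le(3) order_trans[OF norm_ge_zero le(1)] order_trans[OF norm_ge_zero le(2)]
    unfolding C2_norm_def by linarith
qed

text \<open>The sharp constant is half of this one.\<close>

lemma C2_Taylor:
  fixes f :: "(real^'n) set \<Rightarrow> 'b::real_normed_vector"
  assumes "L > 0" "torus_C2 L f"
  shows "norm (f (torus_proj L (x + h)) - f (torus_proj L x) - tderiv f (torus_proj L x) h)
           \<le> C2_norm L f * (norm h)\<^sup>2"
proof -
  let ?F = "\<lambda>y. f (torus_proj L y)" and ?D = "\<lambda>y. tderiv f (torus_proj L y)"
  let ?M = "C2_norm L f"
  have diff: "torus_differentiable L f" "torus_differentiable L (tderiv f)"
    using assms(2) by (auto simp: torus_C2_def)
  have M0: "0 \<le> ?M"
    using norm_tderiv_tderiv_le_C2_norm[OF assms] norm_ge_zero order_trans by blast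
  have Lip: "norm (?D y - ?D x) \<le> ?M * norm (y - x)" for y
    by (rule differentiable_bound[where S = UNIV])
      (use has_derivative_tderiv[OF diff(2)] norm_tderiv_tderiv_le_C2_norm[OF assms]
        in \<open>auto simp: norm_blinfun.rep_eq\<close>)
  have "norm (?F (x + h) - ?F x - ?D x (x + h - x)) \<le> norm (x + h - x) * (?M * norm h)"
  proof (rule differentiable_bound_linearization[where S = "cball x (norm h)"])
    show "x + t *\<^sub>R (x + h - x) \<in> cball x (norm h)" if "t \<in> {0..1}" for t
      using that by (auto simp: dist_norm mult_left_le_one_le)
    show "(?F has_derivative ?D y) (at y within cball x (norm h))" for y
      by (rule has_derivative_at_withinI[OF has_derivative_tderiv[OF diff(1)]])
    show "onorm (blinfun_apply (?D y) - blinfun_apply (?D x)) \<le> ?M * norm h"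
      if "y \<in> cball x (norm h)" for y
    proof -
      have "onorm (blinfun_apply (?D y) - blinfun_apply (?D x)) = norm (?D y - ?D x)"
        by (simp add: norm_blinfun.rep_eq minus_blinfun.rep_eq fun_diff_def)
      also have "\<dots> \<le> ?M * norm (y - x)" by (rule Lip)
      also have "\<dots> \<le> ?M * norm h"
        using that M0 by (intro mult_left_mono) (auto simp: dist_norm norm_minus_commute)
      finally show ?thesis .
    qed
  qed simp
  then show ?thesis by (simp add: power2_eq_square algebra_simps)
qed

section \<open>Integrals of periodic functions over a period cell\<close>

text \<open>Periodicity is needed in the direction of the shift only. The box swept out by the cell is cut once at
  height \<open>L\<close> and once at height \<open>t\<close>; the two end slabs are translates of each other by a period.\<close>

lemma integral_periodic_shift:
  fixes f :: "real^'n \<Rightarrow> real"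
  assumes cont: "continuous_on UNIV f" and per: "\<And>x. f (x + axis i L) = f x"
    and t: "0 \<le> t" "t \<le> L"
  shows "integral (cbox 0 (\<chi> j. L)) (\<lambda>x. f (x + axis i t)) = integral (cbox 0 (\<chi> j. L)) f"
proof -
  let ?one = "(\<chi> j. L) :: real^'n" and ?c = "axis i t :: real^'n"
  let ?c' = "(\<chi> j. if j = i then t else L) :: real^'n"
  let ?Q = "cbox 0 (?one + ?c)"
  have int: "(f has_integral integral (cbox a b) f) (cbox a b)" for a b
    by (intro integrable_integral integrable_continuous continuous_on_subset[OF cont]) simp
  have split: "integral ?Q f = integral (cbox 0 p) f + integral (cbox q (?one + ?c)) f"
    if "cbox 0 p = ?Q \<inter> {x. x \<bullet> axis i 1 \<le> s}" "cbox q (?one + ?c) = ?Q \<inter> {x. x \<bullet> axis i 1 \<ge> s}" for p q s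
    by (rule integral_unique, rule has_integral_split[where k = "axis i 1" and c = s])
      (use int[of 0 p] int[of q "?one + ?c"] that in \<open>auto simp: axis_in_Basis_iff\<close>)
  have ax: "axis i r $ j = (if j = i then r else 0)" for r :: real and j
    by (simp add: axis_def)
  have "integral ?Q f = integral (cbox 0 ?one) f + integral (cbox (axis i L) (?one + ?c)) f"
    by (rule split[of _ L])
      (use t in \<open>auto simp: mem_box_cart ax inner_axis split: if_splits, smt+\<close>)
  moreover have "integral ?Q f = integral (cbox 0 ?c') f + integral (cbox ?c (?one + ?c)) f"
    by (rule split[of _ t])
      (use t in \<open>auto simp: mem_box_cart ax inner_axis split: if_splits, smt+\<close>)
  moreover have "integral (cbox (axis i L) (?one + ?c)) f = integral (cbox 0 ?c') f"
  proof -
    have "?one + ?c = ?c' + axis i L"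
      by (simp add: vec_eq_iff ax)
    then have "integral (cbox (axis i L) (?one + ?c)) f = integral (cbox 0 ?c') (f \<circ> (+) (axis i L))"
      using integral_shift_cbox_plus[of 0 ?c' f "axis i L"] by simp
    also have "f \<circ> (+) (axis i L) = f"
      using per by (auto simp: add.commute)
    finally show ?thesis .
  qed
  moreover have "integral (cbox 0 ?one) (\<lambda>x. f (x + ?c)) = integral (cbox ?c (?one + ?c)) f"
    using integral_shift_cbox_plus[of 0 ?one f ?c] by (simp add: o_def add.commute)
  ultimately show ?thesis by simp
qed

lemma integral_periodic_shift_minus:
  fixes f :: "real^'n \<Rightarrow> real"
  assumes cont: "continuous_on UNIV f" and per: "\<And>x. f (x + axis i L) = f x"
    and t: "0 \<le> t" "t \<le> L"
  shows "integral (cbox 0 (\<chi> j. L)) (\<lambda>x. f (x - axis i t)) = integral (cbox 0 (\<chi> j. L)) f"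
proof -
  let ?h = "\<lambda>x. f (x - axis i t)"
  have "continuous_on UNIV ?h"
    by (intro continuous_on_compose2[OF cont]) (auto intro!: continuous_intros)
  moreover have "?h (x + axis i L) = ?h x" for x
    using per[of "x - axis i t"] by (simp add: algebra_simps)
  ultimately show ?thesis
    using integral_periodic_shift[of ?h i L t] t by simp
qed

text \<open>The terms with factor \<open>K\<close> cancel after integration; their purpose is to make all the coefficients
  \<open>v y $ i + K\<close> and \<open>K\<close> of increments of \<open>g\<close> nonnegative when \<open>K\<close> bounds \<open>v\<close>, so that one-sided bounds
  on these increments suffice.\<close>

lemma integral_upwind_by_parts:
  fixes v :: "real^'n \<Rightarrow> real^'n" and g :: "real^'n \<Rightarrow> real"
  assumes v: "continuous_on UNIV v" "\<And>i x. v (x + axis i L) = v x"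
    and g: "continuous_on UNIV g" "\<And>i x. g (x + axis i L) = g x"
    and t: "0 \<le> t" "t \<le> L"
  shows "integral (cbox 0 (\<chi> j. L)) (\<lambda>y. \<Sum>i\<in>UNIV. (v y $ i + K) * (g (y + axis i t) - g y)
             + K * (g (y - axis i t) - g y))
       = integral (cbox 0 (\<chi> j. L)) (\<lambda>y. g y * (\<Sum>i\<in>UNIV. v (y - axis i t) $ i - v y $ i))"
proof -
  let ?Q = "cbox 0 (\<chi> j. L) :: (real^'n) set"
  have vc: "continuous_on S (\<lambda>y. v (h y))" and gc: "continuous_on S (\<lambda>y. g (h y))"
    if "continuous_on S h" for h and S :: "(real^'n) set"
    by (rule continuous_on_compose2[OF v(1) that] continuous_on_compose2[OF g(1) that]; simp)+
  have int: "f integrable_on ?Q" if "continuous_on UNIV f" for f :: "real^'n \<Rightarrow> real"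
    by (intro integrable_continuous continuous_on_subset[OF that]) simp
  note cont = vc gc continuous_intros
  have "integral ?Q (\<lambda>y. (v y $ i + K) * (g (y + axis i t) - g y) + K * (g (y - axis i t) - g y))
      = integral ?Q (\<lambda>y. g y * (v (y - axis i t) $ i - v y $ i))" for i
  proof -
    let ?F = "\<lambda>y. (v (y - axis i t) $ i + K) * g y"
    have per: "?F (y + axis i L) = ?F y" for y
      using v(2)[of "y - axis i t" i] g(2)[of y i] by (simp add: algebra_simps)
    have "integral ?Q (\<lambda>y. ?F (y + axis i t)) = integral ?Q ?F"
      by (rule integral_periodic_shift[where f = ?F, OF _ per t]) (intro cont)
    then have F: "integral ?Q (\<lambda>y. (v y $ i + K) * g (y + axis i t)) = integral ?Q ?F"
      by simp
    have G: "integral ?Q (\<lambda>y. g (y - axis i t)) = integral ?Q g"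
      by (rule integral_periodic_shift_minus[OF g t])
    have "integral ?Q (\<lambda>y. (v y $ i + K) * (g (y + axis i t) - g y) + K * (g (y - axis i t) - g y))
       = integral ?Q (\<lambda>y. ((v y $ i + K) * g (y + axis i t) - (v y $ i + K) * g y) + (K * g (y - axis i t) - K * g y))"
      by (simp add: algebra_simps)
    also have "\<dots> = integral ?Q (\<lambda>y. (v y $ i + K) * g (y + axis i t)) - integral ?Q (\<lambda>y. (v y $ i + K) * g y)
         + (integral ?Q (\<lambda>y. K * g (y - axis i t)) - integral ?Q (\<lambda>y. K * g y))"
      by (subst integral_add integral_diff, (intro int cont)+)+ simp
    also have "\<dots> = integral ?Q ?F - integral ?Q (\<lambda>y. (v y $ i + K) * g y)"
      by (simp only: F G integral_mult_right add_diff_cancel_right' diff_self add_0_right)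
    also have "\<dots> = integral ?Q (\<lambda>y. ?F y - (v y $ i + K) * g y)"
      by (subst integral_diff, (intro int cont)+) simp
    also have "\<dots> = integral ?Q (\<lambda>y. g y * (v (y - axis i t) $ i - v y $ i))"
      by (simp add: algebra_simps)
    finally show ?thesis .
  qed
  then show ?thesis
    by (simp add: sum_distrib_left) (subst integral_sum integral_sum, simp, (intro int cont)+, simp)+
qed

text \<open>If a periodic function \<open>g\<close> decreases along \<open>v\<close> at least at the rate \<open>c w\<close>, in the discrete sense and up to
  errors of order \<open>t\<^sup>2\<close>, and the sum of the backward increments of \<open>v\<close> is nonnegative up to that order,
  then \<open>w\<close> vanishes on the period cell.\<close>

lemma weight_zero_of_upwind_bound:
  fixes v :: "real^'n \<Rightarrow> real^'n" and g w :: "real^'n \<Rightarrow> real"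
  assumes "L > 0"
    and v: "continuous_on UNIV v" "\<And>i x. v (x + axis i L) = v x"
    and g: "continuous_on UNIV g" "\<And>i x. g (x + axis i L) = g x" "\<And>x. 0 \<le> g x" "\<And>x. g x \<le> G"
    and w: "continuous_on UNIV w" "\<And>x. 0 \<le> w x"
    and c: "c > 0" and C: "0 \<le> C" "0 \<le> C'"
    and div: "\<And>t y. 0 < t \<Longrightarrow> - C' * t\<^sup>2 \<le> (\<Sum>i\<in>UNIV. v (y - axis i t) $ i - v y $ i)"
    and upwind: "\<And>t y. 0 < t \<Longrightarrow>
       (\<Sum>i\<in>UNIV. (v y $ i + K) * (g (y + axis i t) - g y) + K * (g (y - axis i t) - g y))
         \<le> - c * t * w y + C * t\<^sup>2"
    and y: "y \<in> cbox 0 (\<chi> j. L)"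
  shows "w y = 0"
proof -
  let ?Q = "cbox 0 (\<chi> j. L) :: (real^'n) set"
  let ?m = "measure lborel ?Q"
  have vc: "continuous_on S (\<lambda>y. v (h y))" and gc: "continuous_on S (\<lambda>y. g (h y))"
    and wc: "continuous_on S (\<lambda>y. w (h y))"
    if "continuous_on S h" for h and S :: "(real^'n) set"
    by (rule continuous_on_compose2[OF v(1) that] continuous_on_compose2[OF g(1) that]
        continuous_on_compose2[OF w(1) that]; simp)+
  have int: "f integrable_on ?Q" if "continuous_on UNIV f" for f :: "real^'n \<Rightarrow> real"
    by (intro integrable_continuous continuous_on_subset[OF that]) simp
  note cont = vc gc wc continuous_intros
  have G0: "0 \<le> G" using g(3,4) order_trans by blast
  have bound: "c * integral ?Q w \<le> t * ((C + G * C') * ?m)" if t: "0 < t" "t \<le> L" for t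
  proof -
    let ?S = "\<lambda>y. \<Sum>i\<in>UNIV. (v y $ i + K) * (g (y + axis i t) - g y) + K * (g (y - axis i t) - g y)"
    let ?R = "\<lambda>y. g y * (\<Sum>i\<in>UNIV. v (y - axis i t) $ i - v y $ i)"
    have "- G * C' * t\<^sup>2 \<le> ?R y" for y
    proof -
      have "g y * (C' * t\<^sup>2) \<le> G * (C' * t\<^sup>2)"
        using g(4) C(2) by (intro mult_right_mono) auto
      moreover have "g y * (- C' * t\<^sup>2) \<le> ?R y"
        by (intro mult_left_mono div g(3) t(1))
      ultimately show ?thesis by (simp add: algebra_simps)
    qed
    then have "integral ?Q (\<lambda>y. - G * C' * t\<^sup>2) \<le> integral ?Q ?R"
      by (intro integral_le int cont)
    also have "\<dots> = integral ?Q ?S"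
      using integral_upwind_by_parts[OF v g(1,2), of t K] t by simp
    also have "\<dots> \<le> integral ?Q (\<lambda>y. - c * t * w y + C * t\<^sup>2)"
      by (intro integral_le int cont upwind t(1))
    also have "\<dots> = - c * t * integral ?Q w + C * t\<^sup>2 * ?m"
      by (subst integral_add, (intro int cont)+) simp
    finally have "t * (c * integral ?Q w) \<le> t * (t * ((C + G * C') * ?m))"
      by (simp add: algebra_simps power2_eq_square)
    then show ?thesis using t(1) by simp
  qed
  have "((\<lambda>t. t * ((C + G * C') * ?m)) \<longlongrightarrow> 0 * ((C + G * C') * ?m)) (at_right 0)"
    by (intro tendsto_intros)
  moreover have "\<forall>\<^sub>F t in at_right 0. c * integral ?Q w \<le> t * ((C + G * C') * ?m)"
    using bound \<open>L > 0\<close> by (auto simp: eventually_at_right_field intro!: exI[of _ L])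
  ultimately have "c * integral ?Q w \<le> 0 * ((C + G * C') * ?m)"
    by (rule tendsto_lowerbound) simp
  then have "integral ?Q w \<le> 0"
    using c by (simp add: mult_le_0_iff)
  moreover have "0 \<le> integral ?Q w"
    by (rule integral_nonneg[OF int[OF w(1)]]) (use w(2) in auto)
  ultimately have "integral ?Q w = 0" by simp
  moreover have "box 0 ((\<chi> j. L) :: real^'n) \<noteq> {}"
    using \<open>L > 0\<close> by (simp add: interval_ne_empty_cart)
  moreover have "continuous_on ?Q w"
    using w(1) continuous_on_subset by blast
  ultimately show ?thesis
    using integral_cbox_eq_0_iff[of 0 "\<chi> j. L" w] w(2) y by blast
qed

section \<open>The distance to a certificate\<close>

lemma torus_proj_mem_of_Union:
  assumes "torus_closed L D" "x \<in> \<Union>D"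
  shows "torus_proj L x \<in> D"
  using assms torus_eq_torus_proj unfolding torus_closed_def by blast

lemma Union_add_lattice:
  assumes "torus_closed L D" "x \<in> \<Union>D" "z \<in> lattice L"
  shows "x + z \<in> \<Union>D"
  using torus_proj_mem_of_Union[OF assms(1,2)] torus_proj_add_lattice[OF assms(3), of x]
    torus_proj_self[of "x + z" L] by auto

lemma nonempty_of_mem_torus: "p \<in> torus L \<Longrightarrow> p \<noteq> {}"
  using torus_proj_self unfolding torus_def by blast

lemma Union_nonempty:
  assumes "torus_closed L D" "D \<noteq> {}"
  shows "\<Union>D \<noteq> {}"
  using assms nonempty_of_mem_torus unfolding torus_closed_def by blast

lemma infdist_Union_add_lattice:
  assumes D: "torus_closed L D" and z: "z \<in> lattice L"
  shows "infdist (y + z) (\<Union>D) = infdist y (\<Union>D)"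
proof (cases "D = {}")
  case False
  have le: "infdist (y + z) (\<Union>D) \<le> infdist y (\<Union>D)" if z: "z \<in> lattice L" for y z
  proof -
    obtain x where x: "x \<in> \<Union>D" "infdist y (\<Union>D) = dist y x"
      using infdist_attains_inf[OF _ Union_nonempty[OF D False]] D
      unfolding torus_closed_def by blast
    show ?thesis
      using infdist_le[OF Union_add_lattice[OF D x(1) z], of "y + z"] by (simp add: x(2))
  qed
  show ?thesis
    using le[OF z, of y] le[OF lattice_uminus[OF z], of "y + z"] by simp
qed (simp add: infdist_def)

lemma torus_infdist_le_infdist:
  assumes D: "torus_closed L D" "D \<noteq> {}"
  shows "torus_infdist (torus_proj L y) D \<le> infdist y (\<Union>D)"
proof -
  obtain x where x: "x \<in> \<Union>D" "infdist y (\<Union>D) = dist y x"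
    using infdist_attains_inf[OF _ Union_nonempty[OF D]] D
    unfolding torus_closed_def by blast
  have "torus_infdist (torus_proj L y) D \<le> torus_dist (torus_proj L y) (torus_proj L x)"
    unfolding torus_infdist_def
    by (rule cINF_lower) (auto intro!: bdd_belowI[of _ 0] torus_proj_mem_of_Union[OF D(1) x(1)]
        simp: torus_dist_def setdist_pos_le)
  also have "\<dots> \<le> dist y x"
    unfolding torus_dist_def by (rule setdist_le_dist) auto
  finally show ?thesis using x(2) by simp
qed

lemma unit_proximal_normal_of_nearest:
  assumes D: "torus_closed L D" and x: "x \<in> \<Union>D" "infdist y (\<Union>D) = dist y x"
    and dist: "0 < dist y x" "dist y x < L / 2"
  shows "unit_proximal_normal L D (torus_proj L x) ((y - x) /\<^sub>R dist y x)"
proof -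
  have y: "torus_proj L x \<oplus>\<^sub>T dist y x *\<^sub>R ((y - x) /\<^sub>R dist y x) = torus_proj L y"
    using dist by (simp add: tshift_torus_proj)
  have "torus_dist (torus_proj L y) (torus_proj L x) \<le> torus_dist (torus_proj L y) q"
    if q: "q \<in> D" for q
  proof -
    have "torus_dist (torus_proj L y) (torus_proj L x) \<le> dist y x"
      unfolding torus_dist_def by (rule setdist_le_dist) auto
    also have "dist y x \<le> torus_dist (torus_proj L y) q"
      unfolding torus_dist_def
    proof (rule le_setdistI)
      show "torus_proj L y \<noteq> {}" using torus_proj_self by blast
      show "q \<noteq> {}"
        using D q nonempty_of_mem_torus unfolding torus_closed_def by blast
      show "dist y x \<le> dist y' z" if "y' \<in> torus_proj L y" "z \<in> q" for y' z
        using infdist_le[of z "\<Union>D" y'] that q infdist_Union_add_lattice[OF D, of "y' - y" y] x(2)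
        by (auto simp: mem_torus_proj_iff)
    qed
    finally show ?thesis .
  qed
  then show ?thesis
    using dist torus_proj_mem_of_Union[OF D x(1)]
    unfolding unit_proximal_normal_def y[symmetric]
    by (auto simp: dist_norm intro!: exI[of _ "dist y x"])
qed

lemma inner_strain: "q \<bullet> (strain V p *v q) = q \<bullet> (jacobian V p *v q)"
proof -
  have "q \<bullet> (transpose (jacobian V p) *v q) = q \<bullet> (jacobian V p *v q)"
    by (metis dot_lmul_matrix inner_commute transpose_matrix_vector)
  then show ?thesis
    by (simp add: strain_def scaleR_matrix_vector_assoc[symmetric] matrix_vector_mult_add_rdistrib
        inner_add_right)
qed

lemma jacobian_mult: "jacobian V p *v q = tderiv V p q"
  unfolding jacobian_def by (rule matrix_works)
    (unfold linear_matrix_vector_mul_eq, rule bounded_linear.linear, rule blinfun.bounded_linear_right)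

text \<open>The only place where the inequality \<open>H \<le> \<epsilon>\<close> of a certificate is used. The bound on \<open>C2_norm L V * dist y x\<close> makes the Taylor
  remainder at most a quarter of the main term \<open>\<rho> / d\<close>, and \<open>2 * d * \<epsilon> \<le> dist y x\<close> makes \<open>\<epsilon>\<close> at most
  half of it.\<close>

lemma inward_drift_near_certificate:
  fixes V :: "(real^'n) set \<Rightarrow> real^'n"
  assumes "L > 0" "d > 0" and C2: "torus_C2 L V"
    and cert: "barrier_certificate L (hamiltonian d V) \<epsilon> D"
    and x: "x \<in> \<Union>D" "infdist y (\<Union>D) = dist y x"
    and dist: "0 < dist y x" "2 * d * \<epsilon> \<le> dist y x" "dist y x \<le> d" "dist y x < L / 2"
      "C2_norm L V * dist y x \<le> 1 / (4 * d)"
  shows "(y - x) \<bullet> V (torus_proj L y) \<le> - (dist y x)\<^sup>2 / (4 * d)"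
proof -
  define \<rho> where "\<rho> = dist y x"
  define \<nu> where "\<nu> = (y - x) /\<^sub>R \<rho>"
  define \<alpha> where "\<alpha> = V (torus_proj L x) \<bullet> \<nu>"
  define \<beta> where "\<beta> = \<nu> \<bullet> tderiv V (torus_proj L x) \<nu>"
  define M where "M = C2_norm L V"
  have \<rho>: "0 < \<rho>" "2 * d * \<epsilon> \<le> \<rho>" "\<rho> \<le> d" "M * \<rho> \<le> 1 / (4 * d)"
    using dist by (simp_all add: \<rho>_def M_def)
  have yx: "y = x + \<rho> *\<^sub>R \<nu>" and norm_\<nu>: "norm \<nu> = 1"
    using \<rho>(1) by (auto simp: \<nu>_def) (simp add: \<rho>_def dist_norm)
  have "torus_closed L D"
    using cert by (simp add: barrier_certificate_def)
  from unit_proximal_normal_of_nearest[OF this x dist(1,4)]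
  have "hamiltonian d V (torus_proj L x) \<nu> \<le> \<epsilon>"
    using cert unfolding barrier_certificate_def \<nu>_def \<rho>_def
    by (auto simp: unit_proximal_normal_def)
  moreover have "\<nu> \<noteq> 0" using norm_\<nu> by auto
  ultimately have H: "max (1 + d * \<beta>) 0 + \<alpha> \<le> \<epsilon>"
    by (simp add: hamiltonian_def inner_strain jacobian_mult norm_\<nu> \<alpha>_def \<beta>_def)
  have "V (torus_proj L y) \<bullet> \<nu> \<le> \<alpha> + \<rho> * \<beta> + M * \<rho>\<^sup>2"
  proof -
    let ?R = "V (torus_proj L y) - V (torus_proj L x) - tderiv V (torus_proj L x) (\<rho> *\<^sub>R \<nu>)"
    have "?R \<bullet> \<nu> \<le> norm ?R"
      using norm_cauchy_schwarz[of ?R \<nu>] norm_\<nu> by simp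
    also have "\<dots> \<le> M * \<rho>\<^sup>2"
      using C2_Taylor[OF assms(1) C2, of x "\<rho> *\<^sub>R \<nu>"] norm_\<nu> by (simp add: yx M_def)
    finally show ?thesis
      by (simp add: inner_diff_right \<alpha>_def \<beta>_def blinfun.scaleR_right inner_commute)
  qed
  also have "\<alpha> + \<rho> * \<beta> \<le> \<epsilon> - \<rho> / d"
  proof -
    \<comment> \<open>The convex combination of \<open>1 + d * \<beta> + \<alpha> \<le> \<epsilon>\<close> and \<open>\<alpha> \<le> \<epsilon>\<close>; this needs \<open>\<rho> \<le> d\<close>.\<close>
    have "0 \<le> (\<rho> / d) * (\<epsilon> - 1 - d * \<beta> - \<alpha>)" "0 \<le> (1 - \<rho> / d) * (\<epsilon> - \<alpha>)"
      using H \<rho> \<open>d > 0\<close> by (auto intro!: mult_nonneg_nonneg)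
    then have "0 \<le> (\<rho> / d) * (\<epsilon> - 1 - d * \<beta> - \<alpha>) + (1 - \<rho> / d) * (\<epsilon> - \<alpha>)"
      by (rule add_nonneg_nonneg)
    also have "\<dots> = \<epsilon> - \<rho> / d - (\<alpha> + \<rho> * \<beta>)"
      using \<open>d > 0\<close> by (simp add: field_simps)
    finally show ?thesis by simp
  qed
  also have "\<epsilon> - \<rho> / d + M * \<rho>\<^sup>2 \<le> - \<rho> / (4 * d)"
  proof -
    have "M * \<rho> * \<rho> \<le> 1 / (4 * d) * \<rho>"
      using \<rho> by (intro mult_right_mono) auto
    moreover have "\<epsilon> \<le> \<rho> / (2 * d)"
      using \<rho>(2) \<open>d > 0\<close> by (simp add: field_simps)
    moreover have "\<rho> / (2 * d) = 2 * (\<rho> / (4 * d))" "\<rho> / d = 4 * (\<rho> / (4 * d))"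
      "1 / (4 * d) * \<rho> = \<rho> / (4 * d)" "- \<rho> / (4 * d) = - (\<rho> / (4 * d))" "M * \<rho>\<^sup>2 = M * \<rho> * \<rho>"
      by (simp_all add: power2_eq_square)
    ultimately show ?thesis by linarith
  qed
  finally have "V (torus_proj L y) \<bullet> \<nu> \<le> - \<rho> / (4 * d)" by simp
  then have "\<rho> * (V (torus_proj L y) \<bullet> \<nu>) \<le> \<rho> * (- \<rho> / (4 * d))"
    using \<rho>(1) by (intro mult_left_mono) auto
  moreover have "(y - x) \<bullet> V (torus_proj L y) = \<rho> * (V (torus_proj L y) \<bullet> \<nu>)"
    by (simp add: yx inner_commute)
  ultimately show ?thesis
    by (simp add: \<rho>_def power2_eq_square)
qed

section \<open>A semiconcave test function\<close>

text \<open>The squared distance to \<open>E\<close>, truncated above at \<open>b\<^sup>2\<close> and counted from the level \<open>A\<close> on. Its square is the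
  test function: the truncation from above is a minimum and keeps semiconcavity; the truncation from below does
  not, but the square of a positive part is nondecreasing and \<open>C\<^sup>1\<close> with Lipschitz derivative.\<close>

definition shell_height :: "(real^'n) set \<Rightarrow> real \<Rightarrow> real \<Rightarrow> real^'n \<Rightarrow> real" where
  "shell_height E A b y = max 0 (min ((infdist y E)\<^sup>2) (b\<^sup>2) - A)"

text \<open>A continuous function that is positive exactly where the squared distance to \<open>E\<close> is positive and lies
  strictly between \<open>A\<close> and \<open>b\<^sup>2\<close>.\<close>

definition shell_weight :: "(real^'n) set \<Rightarrow> real \<Rightarrow> real \<Rightarrow> real^'n \<Rightarrow> real" where
  "shell_weight E A b y = (infdist y E)\<^sup>2 * max 0 ((infdist y E)\<^sup>2 - A) * max 0 (b\<^sup>2 - (infdist y E)\<^sup>2)"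

lemma shell_weight_nonneg: "0 \<le> shell_weight E A b y"
  by (simp add: shell_weight_def)

lemma continuous_shell_height: "continuous_on S (shell_height E A b)"
  unfolding shell_height_def[abs_def] by (intro continuous_intros)

lemma continuous_shell_weight: "continuous_on S (shell_weight E A b)"
  unfolding shell_weight_def[abs_def] by (intro continuous_intros)

lemma shell_height_le:
  assumes "0 \<le> A"
  shows "0 \<le> shell_height E A b y" "shell_height E A b y \<le> b\<^sup>2"
  using assms by (auto simp: shell_height_def)

text \<open>Semiconcavity of the test function, with \<open>x\<close> a nearest point of \<open>E\<close> to \<open>y\<close>. No differentiability of the
  distance is assumed or needed.\<close>

lemma shell_height_sq_increment:
  assumes "0 \<le> A" "0 < b" and x: "x \<in> E" "infdist y E = dist y x"
  shows "(shell_height E A b (y + h))\<^sup>2 - (shell_height E A b y)\<^sup>2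
     \<le> (if dist y x < b then 4 * shell_height E A b y * ((y - x) \<bullet> h) else 0) + 6 * b\<^sup>2 * (norm h)\<^sup>2"
proof (cases "dist y x < b")
  case False
  then have "b\<^sup>2 \<le> (infdist y E)\<^sup>2"
    using assms by (simp add: power_mono)
  then have "shell_height E A b (y + h) \<le> shell_height E A b y"
    by (auto simp: shell_height_def)
  then have "(shell_height E A b (y + h))\<^sup>2 \<le> (shell_height E A b y)\<^sup>2"
    using shell_height_le(1)[OF assms(1)] by (intro power_mono) auto
  then have "(shell_height E A b (y + h))\<^sup>2 - (shell_height E A b y)\<^sup>2 \<le> 0" by simp
  also have "0 \<le> 6 * b\<^sup>2 * (norm h)\<^sup>2" by simp
  finally show ?thesis using False by simp
next
  case True
  let ?\<rho> = "infdist y E" and ?\<rho>' = "infdist (y + h) E"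
  define u u' m m' where "u = min (?\<rho>\<^sup>2) (b\<^sup>2)" and "u' = min (?\<rho>'\<^sup>2) (b\<^sup>2)"
    and "m = max 0 (u - A)" and "m' = max 0 (u' - A)"
  have m: "0 \<le> m" "m \<le> b\<^sup>2"
    using assms(1) by (auto simp: m_def u_def)
  \<comment> \<open>The positive part \<open>m'\<close> is \<open>0\<close> or \<open>u' - A\<close>, and the latter is at most \<open>m + (u' - u)\<close>.\<close>
  have "m' \<le> \<bar>m + (u' - u)\<bar>"
    by (auto simp: m_def m'_def)
  then have "m'\<^sup>2 \<le> (m + (u' - u))\<^sup>2"
    by (metis abs_le_square_iff abs_of_nonneg m'_def max.cobounded1)
  then have quad: "m'\<^sup>2 - m\<^sup>2 \<le> 2 * m * (u' - u) + (u' - u)\<^sup>2"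
    by (simp add: power2_sum)
  have "u' - u \<le> 2 * ((y - x) \<bullet> h) + (norm h)\<^sup>2"
  proof -
    have "?\<rho>' \<le> norm (y - x + h)"
      using infdist_le[OF x(1), of "y + h"] by (simp add: dist_norm algebra_simps)
    then have "?\<rho>'\<^sup>2 \<le> (norm (y - x + h))\<^sup>2"
      by (intro power_mono) (auto simp: infdist_nonneg)
    also have "\<dots> = ?\<rho>\<^sup>2 + 2 * ((y - x) \<bullet> h) + (norm h)\<^sup>2"
      by (simp add: x(2) dist_norm power2_norm_eq_inner inner_add_left inner_add_right inner_commute)
    finally have "?\<rho>'\<^sup>2 \<le> ?\<rho>\<^sup>2 + 2 * ((y - x) \<bullet> h) + (norm h)\<^sup>2" .
    moreover have "u = ?\<rho>\<^sup>2"
      using True x(2) by (simp add: u_def power_mono)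
    ultimately show ?thesis by (simp add: u'_def)
  qed
  then have lin: "2 * m * (u' - u) \<le> 2 * m * (2 * ((y - x) \<bullet> h) + (norm h)\<^sup>2)"
    using m(1) by (intro mult_left_mono) auto
  have "\<bar>u' - u\<bar> \<le> 2 * b * norm h"
  proof -
    have min_sq: "min (r\<^sup>2) (b\<^sup>2) = (min r b)\<^sup>2" if "0 \<le> r" for r
      using that \<open>0 < b\<close> power_mono[of r b 2] power_mono[of b r 2] by (cases "r \<le> b") auto
    have "u' - u = (min ?\<rho>' b - min ?\<rho> b) * (min ?\<rho>' b + min ?\<rho> b)"
      unfolding u_def u'_def min_sq[OF infdist_nonneg] by (simp add: power2_eq_square algebra_simps)
    also have "\<bar>\<dots>\<bar> = \<bar>min ?\<rho>' b - min ?\<rho> b\<bar> * (min ?\<rho>' b + min ?\<rho> b)"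
      using infdist_nonneg[of y E] infdist_nonneg[of "y + h" E] \<open>0 < b\<close>
      by (simp add: abs_mult)
    also have "\<dots> \<le> norm h * (2 * b)"
    proof (rule mult_mono)
      have "\<bar>?\<rho>' - ?\<rho>\<bar> \<le> norm h"
        using infdist_triangle_abs[of "y + h" E y] by (simp add: dist_norm)
      then show "\<bar>min ?\<rho>' b - min ?\<rho> b\<bar> \<le> norm h" by linarith
    qed (use infdist_nonneg[of y E] infdist_nonneg[of "y + h" E] \<open>0 < b\<close> in auto)
    finally show ?thesis by (simp add: mult.commute)
  qed
  then have "(u' - u)\<^sup>2 \<le> (2 * b * norm h)\<^sup>2"
    using \<open>0 < b\<close> by (intro power2_le_iff_abs_le[THEN iffD2]) auto
  moreover have "2 * m * (norm h)\<^sup>2 \<le> 2 * b\<^sup>2 * (norm h)\<^sup>2"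
    using m by (intro mult_right_mono) auto
  ultimately have "m'\<^sup>2 - m\<^sup>2 \<le> 4 * m * ((y - x) \<bullet> h) + 6 * b\<^sup>2 * (norm h)\<^sup>2"
    using quad lin by (simp add: algebra_simps power_mult_distrib)
  then show ?thesis
    using True by (simp add: shell_height_def m_def m'_def u_def u'_def)
qed

lemma shell_upwind_bound:
  fixes v :: "real^'n" and b t c K :: real
  assumes "0 \<le> A" "0 < b" "0 < t" and x: "x \<in> E" "infdist y E = dist y x"
    and K: "\<And>i. \<bar>v $ i\<bar> \<le> K"
    and drift: "A < (dist y x)\<^sup>2 \<Longrightarrow> dist y x < b \<Longrightarrow> (y - x) \<bullet> v \<le> - c * (dist y x)\<^sup>2"
    and "0 \<le> c"
  defines "g \<equiv> \<lambda>z. (shell_height E A b z)\<^sup>2"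
  shows "(\<Sum>i\<in>UNIV. (v $ i + K) * (g (y + axis i t) - g y) + K * (g (y - axis i t) - g y))
     \<le> - (4 * c / b\<^sup>2) * t * shell_weight E A b y + (18 * real CARD('n) * K * b\<^sup>2) * t\<^sup>2"
proof -
  define \<mu> where "\<mu> = (if dist y x < b then shell_height E A b y else 0)"
  have K0: "0 \<le> K" using K[of undefined] by simp
  have vK: "0 \<le> v $ i + K" "v $ i + K \<le> 2 * K" for i
    using K[of i] by auto
  have incr: "g (y + h) - g y \<le> 4 * \<mu> * ((y - x) \<bullet> h) + 6 * b\<^sup>2 * (norm h)\<^sup>2" for h
    using shell_height_sq_increment[OF assms(1,2) x, of h] by (auto simp: g_def \<mu>_def)
  have "(v $ i + K) * (g (y + axis i t) - g y) + K * (g (y - axis i t) - g y)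
     \<le> 4 * \<mu> * t * ((y - x) $ i * v $ i) + 18 * K * b\<^sup>2 * t\<^sup>2" for i
  proof -
    have norm_ax: "norm (axis i t :: real^'n) = t"
      using \<open>0 < t\<close> by (simp add: norm_eq_sqrt_inner inner_axis_axis)
    have ax: "(y - x) \<bullet> axis i t = (y - x) $ i * t"
      by (simp add: inner_axis)
    have "(v $ i + K) * (g (y + axis i t) - g y) \<le> (v $ i + K) * (4 * \<mu> * ((y - x) $ i * t) + 6 * b\<^sup>2 * t\<^sup>2)"
      using incr[of "axis i t"] unfolding ax norm_ax by (intro mult_left_mono vK) simp
    moreover have "K * (g (y - axis i t) - g y) \<le> K * (- 4 * \<mu> * ((y - x) $ i * t) + 6 * b\<^sup>2 * t\<^sup>2)"
      using incr[of "- axis i t"] unfolding inner_minus_right norm_minus_cancel ax norm_ax by (intro mult_left_mono K0) simp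
    moreover have "(v $ i + K) * (6 * b\<^sup>2 * t\<^sup>2) \<le> 2 * K * (6 * b\<^sup>2 * t\<^sup>2)"
      by (intro mult_right_mono vK) simp
    ultimately show ?thesis by (simp add: algebra_simps)
  qed
  then have "(\<Sum>i\<in>UNIV. (v $ i + K) * (g (y + axis i t) - g y) + K * (g (y - axis i t) - g y))
     \<le> (\<Sum>i\<in>UNIV. 4 * \<mu> * t * ((y - x) $ i * v $ i) + 18 * K * b\<^sup>2 * t\<^sup>2)"
    by (rule sum_mono)
  also have "\<dots> = 4 * t * (\<mu> * ((y - x) \<bullet> v)) + (18 * real CARD('n) * K * b\<^sup>2) * t\<^sup>2"
    by (simp add: sum.distrib sum_distrib_left[symmetric] inner_vec_def)
  also have "\<mu> * ((y - x) \<bullet> v) \<le> - (c / b\<^sup>2) * shell_weight E A b y"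
  proof (cases "A < (dist y x)\<^sup>2 \<and> dist y x < b")
    case True
    let ?s = "(dist y x)\<^sup>2"
    have lt: "?s < b\<^sup>2" using True by (simp add: power_strict_mono)
    have \<mu>: "\<mu> = ?s - A" and w: "shell_weight E A b y = ?s * \<mu> * (b\<^sup>2 - ?s)"
      using True lt by (simp_all add: \<mu>_def shell_height_def shell_weight_def x(2))
    have "0 \<le> \<mu>" using True \<mu> by simp
    then have "\<mu> * ((y - x) \<bullet> v) \<le> \<mu> * (- c * ?s)"
      using drift True by (intro mult_left_mono) auto
    also have "\<dots> \<le> - (c / b\<^sup>2) * (?s * \<mu> * (b\<^sup>2 - ?s))"
    proof -
      have "0 \<le> c * ?s * \<mu> * (?s / b\<^sup>2)"
        using \<open>0 \<le> \<mu>\<close> \<open>0 \<le> c\<close> by simp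
      also have "\<dots> = - (c / b\<^sup>2) * (?s * \<mu> * (b\<^sup>2 - ?s)) - \<mu> * (- c * ?s)"
        using \<open>0 < b\<close> by (simp add: field_simps)
      finally show ?thesis by simp
    qed
    finally show ?thesis by (simp add: w)
  next
    case False
    have "b\<^sup>2 \<le> (dist y x)\<^sup>2" if "\<not> dist y x < b"
      using that \<open>0 < b\<close> by (simp add: power_mono)
    then have "\<mu> = 0 \<and> shell_weight E A b y = 0"
      using False by (auto simp: \<mu>_def shell_height_def shell_weight_def x(2))
    then show ?thesis by simp
  qed
  finally show ?thesis
    using \<open>0 < t\<close> by (simp add: algebra_simps)
qed

section \<open>Certificates are dense\<close>

lemma divergence_free_difference_bound:
  fixes V :: "(real^'n) set \<Rightarrow> real^'n"
  assumes "L > 0" "torus_C2 L V" "divergence_free L V" "0 < t"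
  shows "- (real CARD('n) * C2_norm L V) * t\<^sup>2
     \<le> (\<Sum>i\<in>UNIV. V (torus_proj L (y - axis i t)) $ i - V (torus_proj L y) $ i)"
proof -
  let ?J = "tderiv V (torus_proj L y)"
  have "- C2_norm L V * t\<^sup>2 - t * ?J (axis i 1) $ i
      \<le> V (torus_proj L (y - axis i t)) $ i - V (torus_proj L y) $ i" for i
  proof -
    let ?R = "V (torus_proj L (y - axis i t)) - V (torus_proj L y) - ?J (- axis i t)"
    have ax: "axis i t = t *\<^sub>R (axis i 1 :: real^'n)"
      by (simp add: vec_eq_iff axis_def)
    have "\<bar>?R $ i\<bar> \<le> norm ?R" by (rule component_le_norm_cart)
    also have "\<dots> \<le> C2_norm L V * t\<^sup>2"
      using C2_Taylor[OF assms(1,2), of y "- axis i t"] by (simp add: norm_eq_sqrt_inner inner_axis_axis)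
    finally show ?thesis
      by (simp add: ax blinfun.scaleR_right blinfun.minus_right)
  qed
  then have "(\<Sum>i\<in>UNIV. - C2_norm L V * t\<^sup>2 - t * ?J (axis i 1) $ i)
      \<le> (\<Sum>i\<in>UNIV. V (torus_proj L (y - axis i t)) $ i - V (torus_proj L y) $ i)"
    by (rule sum_mono)
  moreover have "(\<Sum>i\<in>UNIV. ?J (axis i 1) $ i) = 0"
    using assms(3) by (simp add: divergence_free_def trace_def jacobian_def matrix_def)
  ultimately show ?thesis
    by (simp add: sum_subtractf sum_distrib_left[symmetric] algebra_simps)
qed

lemma infdist_certificate_le:
  fixes V :: "(real^'n) set \<Rightarrow> real^'n"
  assumes "L > 0" "d > 0" and C2: "torus_C2 L V" and div: "divergence_free L V"
    and cert: "barrier_certificate L (hamiltonian d V) \<epsilon> D" and "0 \<le> \<epsilon>"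
    and b: "2 * d * \<epsilon> < b" "b \<le> d" "b \<le> L / 2" "C2_norm L V * b \<le> 1 / (4 * d)"
  shows "infdist y (\<Union>D) \<le> 2 * d * \<epsilon>"
proof (rule ccontr)
  assume "\<not> infdist y (\<Union>D) \<le> 2 * d * \<epsilon>"
  then have far: "2 * d * \<epsilon> < infdist y (\<Union>D)" by simp
  define E where "E = \<Union>D"
  define a where "a = 2 * d * \<epsilon>"
  define v where "v = (\<lambda>x. V (torus_proj L x))"
  define g where "g = (\<lambda>x. (shell_height E (a\<^sup>2) b x)\<^sup>2)"
  have D: "torus_closed L D" "D \<noteq> {}"
    using cert by (simp_all add: barrier_certificate_def)
  have E: "closed E" "E \<noteq> {}"
    using D Union_nonempty[OF D] by (simp_all add: E_def torus_closed_def)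
  have a: "0 \<le> a" "a < b"
    using assms(2,6) b by (simp_all add: a_def)
  have "0 < b" using a by simp
  have M0: "0 \<le> C2_norm L V"
    using norm_tderiv_tderiv_le_C2_norm[OF assms(1) C2] norm_ge_zero order_trans by blast
  have infdist_shift: "infdist (x + z) E = infdist x E" if "z \<in> lattice L" for x z
    using infdist_Union_add_lattice[OF D(1) that] by (simp add: E_def)
  have "torus_continuous L V"
    using C2 torus_differentiable_imp_continuous by (auto simp: torus_C2_def)
  then have v: "continuous_on UNIV v" "\<And>i x. v (x + axis i L) = v x"
    by (auto simp: v_def torus_continuous_def torus_proj_add_lattice axis_in_lattice)
  obtain K where "\<And>x. norm (v x) \<le> K"
    using bounded_torus_image[OF assms(1) \<open>torus_continuous L V\<close>]
    by (force simp: bounded_iff v_def)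
  then have K: "\<bar>v x $ i\<bar> \<le> K" for x i
    using component_le_norm_cart order_trans by blast
  then have K0: "0 \<le> K" using abs_ge_zero order_trans by blast
  have g: "continuous_on UNIV g" "\<And>i x. g (x + axis i L) = g x" "\<And>x. 0 \<le> g x"
    by (auto simp: g_def shell_height_def infdist_shift axis_in_lattice
        intro!: continuous_intros continuous_shell_height)
  have gG: "g x \<le> (b\<^sup>2)\<^sup>2" for x
    using shell_height_le[of "a\<^sup>2" E b x] unfolding g_def by (intro power_mono) auto
  \<comment> \<open>The constants \<open>c\<close> and \<open>C\<close> are those of \<open>shell_upwind_bound\<close> for the drift rate \<open>1 / (4 * d)\<close>.\<close>
  have weight: "shell_weight E (a\<^sup>2) b x = 0" if "x \<in> cbox 0 (\<chi> i. L)" for x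
  proof (rule weight_zero_of_upwind_bound[OF assms(1) v g gG continuous_shell_weight shell_weight_nonneg,
        where C = "18 * real CARD('n) * K * b\<^sup>2" and C' = "real CARD('n) * C2_norm L V"
          and c = "4 * (1 / (4 * d)) / b\<^sup>2" and K = K])
    fix t :: real and x :: "real^'n" assume "0 < t"
    show "- (real CARD('n) * C2_norm L V) * t\<^sup>2 \<le> (\<Sum>i\<in>UNIV. v (x - axis i t) $ i - v x $ i)"
      unfolding v_def by (rule divergence_free_difference_bound[OF assms(1) C2 div \<open>0 < t\<close>])
    obtain z where z: "z \<in> E" "infdist x E = dist x z"
      using infdist_attains_inf[OF E] by blast
    show "(\<Sum>i\<in>UNIV. (v x $ i + K) * (g (x + axis i t) - g x) + K * (g (x - axis i t) - g x))
       \<le> - (4 * (1 / (4 * d)) / b\<^sup>2) * t * shell_weight E (a\<^sup>2) b x + 18 * real CARD('n) * K * b\<^sup>2 * t\<^sup>2"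
      unfolding g_def
    proof (rule shell_upwind_bound[OF _ \<open>0 < b\<close> \<open>0 < t\<close> z K])
      assume gt: "a\<^sup>2 < (dist x z)\<^sup>2" and lt: "dist x z < b"
      have ax: "a < dist x z"
        by (rule power2_less_imp_less[OF gt zero_le_dist])
      have "C2_norm L V * dist x z \<le> C2_norm L V * b"
        using M0 lt by (intro mult_left_mono) auto
      then have "C2_norm L V * dist x z \<le> 1 / (4 * d)"
        using b(4) by (rule order_trans)
      then have "(x - z) \<bullet> V (torus_proj L x) \<le> - (dist x z)\<^sup>2 / (4 * d)"
        using z ax a lt b unfolding E_def a_def
        by (intro inward_drift_near_certificate[OF assms(1,2) C2 cert]) auto
      then show "(x - z) \<bullet> v x \<le> - (1 / (4 * d)) * (dist x z)\<^sup>2"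
        by (simp add: v_def)
    qed (use assms(2) in auto)
  qed (use assms(2) \<open>0 < b\<close> K0 M0 that in auto)
  \<comment> \<open>Since the distance takes all values between \<open>0\<close> and \<open>infdist y E\<close>, some point lies in the open shell.\<close>
  define r where "r = (a + min (infdist y E) b) / 2"
  have r: "a < r" "r < b" "r \<le> infdist y E"
    using far[folded E_def a_def] a by (auto simp: r_def min_def)
  obtain x0 where "x0 \<in> E" using E by blast
  have "connected (range (\<lambda>x. infdist x E))"
    by (intro connected_continuous_image continuous_intros connected_UNIV)
  then have "{infdist x0 E..infdist y E} \<subseteq> range (\<lambda>x. infdist x E)"
    by (intro connected_contains_Icc) auto
  then have "r \<in> range (\<lambda>x. infdist x E)"
    using r a \<open>x0 \<in> E\<close> by auto
  then obtain x where x: "infdist x E = r" by blast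
  obtain z where z: "z \<in> lattice L" "x + z \<in> cbox 0 (\<chi> i. L)"
    using exists_lattice_translate_in_cbox[OF assms(1)] by blast
  have "shell_weight E (a\<^sup>2) b (x + z) = r\<^sup>2 * max 0 (r\<^sup>2 - a\<^sup>2) * max 0 (b\<^sup>2 - r\<^sup>2)"
    by (simp add: shell_weight_def infdist_shift[OF z(1)] x)
  moreover have "a\<^sup>2 < r\<^sup>2" "r\<^sup>2 < b\<^sup>2" "0 < r"
    using r a by (auto intro!: power_strict_mono)
  ultimately show False
    using weight[OF z(2)] by auto
qed

theorem theorem2p5:
  assumes "CARD('n::finite) \<ge> 2"
  shows "\<exists>\<epsilon>\<^sub>0 :: real \<Rightarrow> real \<Rightarrow> real \<Rightarrow> real.
    \<forall>(d::real) (L::real) (V :: (real^'n) set \<Rightarrow> real^'n).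
      d > 0 \<longrightarrow> L > 0 \<longrightarrow> torus_C2 L V \<longrightarrow> divergence_free L V \<longrightarrow>
        \<epsilon>\<^sub>0 d L (C2_norm L V) > 0 \<and>
        (\<forall>\<epsilon> D. 0 \<le> \<epsilon> \<longrightarrow> \<epsilon> \<le> \<epsilon>\<^sub>0 d L (C2_norm L V) \<longrightarrow>
           barrier_certificate L (hamiltonian d V) \<epsilon> D \<longrightarrow>
           covering_radius L D \<le> 2 * d * \<epsilon>) \<and>
        (\<forall>D. exact_barrier_certificate L (hamiltonian d V) D \<longrightarrow> D = torus L)"
proof -
  \<comment> \<open>The shell reaches up to distance \<open>b d L M\<close>; then \<open>\<epsilon> \<le> b d L M / (4 * d)\<close> puts its inner radius
      \<open>2 * d * \<epsilon>\<close> at no more than half of the outer one. The absolute value and the summand \<open>1\<close> keep \<open>b\<close> positive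
      for every argument \<open>M\<close>.\<close>
  define b where "b = (\<lambda>d L M. min (min d (L / 2)) (1 / (4 * d * (\<bar>M\<bar> + 1))) :: real)"
  have "b d L (C2_norm L V) / (4 * d) > 0 \<and>
        (\<forall>\<epsilon> D. 0 \<le> \<epsilon> \<longrightarrow> \<epsilon> \<le> b d L (C2_norm L V) / (4 * d) \<longrightarrow>
           barrier_certificate L (hamiltonian d V) \<epsilon> D \<longrightarrow>
           covering_radius L D \<le> 2 * d * \<epsilon>) \<and>
        (\<forall>D. exact_barrier_certificate L (hamiltonian d V) D \<longrightarrow> D = torus L)"
    if dL: "d > 0" "L > 0" and V: "torus_C2 L V" "divergence_free L V"
    for d L and V :: "(real^'n) set \<Rightarrow> real^'n"
  proof -
    define M where "M = C2_norm L V"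
    define b0 where "b0 = b d L M"
    have "0 < 4 * d * (\<bar>M\<bar> + 1)"
      using dL(1) by (intro mult_pos_pos) auto
    then have b0: "0 < b0" "b0 \<le> d" "b0 \<le> L / 2" "b0 \<le> 1 / (4 * d * (\<bar>M\<bar> + 1))"
      using dL by (simp_all add: b0_def b_def)
    have "M * b0 \<le> (\<bar>M\<bar> + 1) * (1 / (4 * d * (\<bar>M\<bar> + 1)))"
      using b0(1,4) by (intro mult_mono) auto
    also have "\<dots> = 1 / (4 * d)"
    proof -
      have "\<bar>M\<bar> + 1 \<noteq> 0" by linarith
      then show ?thesis by simp
    qed
    finally have M: "M * b0 \<le> 1 / (4 * d)" .
    have dense: "infdist y (\<Union>D) \<le> 2 * d * \<epsilon>"
      if "0 \<le> \<epsilon>" "\<epsilon> \<le> b0 / (4 * d)" "barrier_certificate L (hamiltonian d V) \<epsilon> D" for \<epsilon> D y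
    proof (rule infdist_certificate_le[OF dL(2,1) V that(3,1) _ b0(2,3)])
      have "2 * d * \<epsilon> \<le> 2 * d * (b0 / (4 * d))"
        using that(2) dL(1) by (intro mult_left_mono) auto
      also have "\<dots> = b0 / 2"
        using dL(1) by simp
      finally have "2 * d * \<epsilon> \<le> b0 / 2" .
      then show "2 * d * \<epsilon> < b0" using b0(1) by simp
    qed (use M M_def in simp)
    have "covering_radius L D \<le> 2 * d * \<epsilon>"
      if "0 \<le> \<epsilon>" "\<epsilon> \<le> b0 / (4 * d)" "barrier_certificate L (hamiltonian d V) \<epsilon> D" for \<epsilon> D
      unfolding covering_radius_def
    proof (rule cSUP_least)
      show "torus L \<noteq> {}" by (simp add: torus_def)
      fix p :: "(real^'n) set" assume "p \<in> torus L"
      then obtain y where p: "p = torus_proj L y" by (auto simp: torus_def)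
      have "torus_infdist p D \<le> infdist y (\<Union>D)"
        using that(3) torus_infdist_le_infdist unfolding p barrier_certificate_def by blast
      then show "torus_infdist p D \<le> 2 * d * \<epsilon>"
        using dense[OF that, of y] by simp
    qed
    moreover have "D = torus L" if exact: "exact_barrier_certificate L (hamiltonian d V) D" for D
    proof
      have cert: "barrier_certificate L (hamiltonian d V) 0 D"
        using exact by (simp add: exact_barrier_certificate_def)
      then have D: "torus_closed L D" "D \<noteq> {}"
        by (simp_all add: barrier_certificate_def)
      then show "D \<subseteq> torus L" by (simp add: torus_closed_def)
      show "torus L \<subseteq> D"
      proof
        fix p :: "(real^'n) set" assume "p \<in> torus L"
        then obtain y where p: "p = torus_proj L y" by (auto simp: torus_def)
        have "infdist y (\<Union>D) \<le> 2 * d * 0"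
          by (rule dense[OF _ _ cert]) (use b0(1) dL(1) in auto)
        then have "infdist y (\<Union>D) = 0"
          using infdist_nonneg[of y "\<Union>D"] by linarith
        then have "y \<in> \<Union>D"
          using D(1) in_closed_iff_infdist_zero[OF _ Union_nonempty[OF D]] by (simp add: torus_closed_def)
        then show "p \<in> D" using torus_proj_mem_of_Union[OF D(1)] p by simp
      qed
    qed
    moreover have "0 < b0 / (4 * d)"
      using b0(1) dL(1) by simp
    ultimately show ?thesis
      unfolding b0_def M_def by blast
  qed
  then show ?thesis
    by (intro exI[of _ "\<lambda>d L M. b d L M / (4 * d)"] allI impI)
qed

end
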